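(* Let $L$ be a completely distributive lattice and let $G$ be a group. (1) Suppose $L$ is a chain, let $\mu$ be an $L$-subgroup of $G$ and let $\eta$ be an $L$-subgroup of $\mu$ such that $\eta$ and $\mu$ are jointly supstar. If $\eta$ is a contranormal $L$-subgroup of $\mu$, then $\eta_t$ is a contranormal subgroup of $\mu_t$ for all $t\in L$ with $t\le\operatorname{tip}(\eta)$. (2) Conversely, (with $L$ any completely distributive lattice) let $\mu$ be an $L$-subgroup of $G$ and $\eta$ an $L$-subgroup of $\mu$ such that $\operatorname{tip}(\eta)=\operatorname{tip}(\mu)$. If $\eta_t$ is a contranormal subgroup of $\mu_t$ for all $t\in L$ with $t\le\operatorname{tip}(\eta)$, then $\eta$ is a contranormal $L$-subgroup of $\mu$.
   Context: $L$ is a completely distributive (in particular complete) lattice with greatest element $1$ and least element $0$; $G$ is a group with identity $e$. An $L$-subset of $G$ is a function $G\to L$; $\operatorname{Im}(\eta)$ is its set of values; $\eta\subseteq\nu$ means $\eta(x)\le\nu(x)$ for all $x\in G$. For $t\in L$ the level subset is $\eta_t=\{x\in G\mid\eta(x)\ge t\}$. An $L$-subgroup of $G$ is an $L$-subset $\mu$ with $\mu(xy)\ge\mu(x)\wedge\mu(y)$ and $\mu(x^{-1})=\mu(x)$ for all $x,y\in G$. Its tip is $\operatorname{tip}(\mu)=\bigvee_{x\in G}\mu(x)=\mu(e)$. An $L$-subgroup of $\mu$ is an $L$-subgroup $\eta$ of $G$ with $\eta\subseteq\mu$. For $t\le\operatorname{tip}(\eta)$, $\eta_t$ is a subgroup of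 $\mu_t$. A non-empty subset $X$ of $L$ is supstar if every non-empty subset $A$ of $X$ contains its supremum. Two $L$-subsets $\eta,\theta$ are jointly supstar if $\operatorname{Im}(\eta)\cup\operatorname{Im}(\theta)$ is a supstar subset of $L$. For $a\in L$, $z\in G$, the $L$-point $a_z$ is the $L$-subset with value $a$ at $z$ and $0$ elsewhere; $a_z\in\mu$ means $\mu(z)\ge a$. For $\eta$ an $L$-subgroup of $\mu$ and $a_z\in\mu$, the conjugate $\eta^{a_z}$ is the $L$-subset $\eta^{a_z}(x)=a\wedge\eta(zxz^{-1})$, $x\in G$. An $L$-subgroup $\eta$ of $\mu$ is a contranormal $L$-subgroup of $\mu$ if there is no $L$-subgroup $\theta$ of $\mu$ with $\theta\neq\mu$ such that $\eta^{a_z}\subseteq\theta$ for every $L$-point $a_z\in\mu$. A subgroup $H$ of a group $K$ is contranormal in $K$ if the normal closure of $H$ in $K$ is $K$ (equivalently, no proper subgroup of $K$ contains all the conjugates of $H$ in $K$). *)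

theory Defs
  imports "HOL-Algebra.Coset"
begin

text \<open>
  An \<open>L\<close>-subset of a group \<open>G\<close> is represented by a function on the whole element type of which
  only the values on \<open>carrier G\<close> matter; inclusion, equality, image, tip and level subsets are
  therefore relativised to \<open>carrier G\<close>.
\<close>

definition lsub_le :: "('a, 'b) monoid_scheme \<Rightarrow> ('a \<Rightarrow> 'l::complete_lattice) \<Rightarrow> ('a \<Rightarrow> 'l) \<Rightarrow> bool"
  where "lsub_le G \<eta> \<nu> \<longleftrightarrow> (\<forall>x\<in>carrier G. \<eta> x \<le> \<nu> x)"

definition lsub_eq :: "('a, 'b) monoid_scheme \<Rightarrow> ('a \<Rightarrow> 'l::complete_lattice) \<Rightarrow> ('a \<Rightarrow> 'l) \<Rightarrow> bool"
  where "lsub_eq G \<eta> \<nu> \<longleftrightarrow> (\<forall>x\<in>carrier G. \<eta> x = \<nu> x)"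

definition level_set :: "('a, 'b) monoid_scheme \<Rightarrow> ('a \<Rightarrow> 'l::complete_lattice) \<Rightarrow> 'l \<Rightarrow> 'a set"
  where "level_set G \<eta> t = {x \<in> carrier G. t \<le> \<eta> x}"

definition lsub_tip :: "('a, 'b) monoid_scheme \<Rightarrow> ('a \<Rightarrow> 'l::complete_lattice) \<Rightarrow> 'l"
  where "lsub_tip G \<mu> = (SUP x\<in>carrier G. \<mu> x)"

definition L_subgroup :: "('a, 'b) monoid_scheme \<Rightarrow> ('a \<Rightarrow> 'l::complete_lattice) \<Rightarrow> bool"
  where "L_subgroup G \<mu> \<longleftrightarrow>
    (\<forall>x\<in>carrier G. \<forall>y\<in>carrier G. inf (\<mu> x) (\<mu> y) \<le> \<mu> (x \<otimes>\<^bsub>G\<^esub> y)) \<and>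
    (\<forall>x\<in>carrier G. \<mu> (inv\<^bsub>G\<^esub> x) = \<mu> x)"

definition L_subgroup_of ::
    "('a, 'b) monoid_scheme \<Rightarrow> ('a \<Rightarrow> 'l::complete_lattice) \<Rightarrow> ('a \<Rightarrow> 'l) \<Rightarrow> bool"
  where "L_subgroup_of G \<eta> \<mu> \<longleftrightarrow> L_subgroup G \<eta> \<and> lsub_le G \<eta> \<mu>"

definition supstar :: "'l::complete_lattice set \<Rightarrow> bool"
  where "supstar X \<longleftrightarrow> X \<noteq> {} \<and> (\<forall>A. A \<subseteq> X \<and> A \<noteq> {} \<longrightarrow> Sup A \<in> A)"

definition jointly_supstar ::
    "('a, 'b) monoid_scheme \<Rightarrow> ('a \<Rightarrow> 'l::complete_lattice) \<Rightarrow> ('a \<Rightarrow> 'l) \<Rightarrow> bool"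
  where "jointly_supstar G \<eta> \<theta> \<longleftrightarrow> supstar (\<eta> ` carrier G \<union> \<theta> ` carrier G)"

text \<open>
  The \<open>L\<close>-point with value \<open>a\<close> at \<open>z\<close> and \<open>0\<close> elsewhere is represented by its data \<open>a\<close>, \<open>z\<close>.
  The pair is determined by the \<open>L\<close>-point unless \<open>a = bot\<close>, and then conjugation by it yields
  the constant \<open>bot\<close> for every \<open>z\<close>.
\<close>

definition lpoint_in ::
    "('a, 'b) monoid_scheme \<Rightarrow> 'l::complete_lattice \<Rightarrow> 'a \<Rightarrow> ('a \<Rightarrow> 'l) \<Rightarrow> bool"
  where "lpoint_in G a z \<mu> \<longleftrightarrow> z \<in> carrier G \<and> a \<le> \<mu> z"

definition lconj ::
    "('a, 'b) monoid_scheme \<Rightarrow> ('a \<Rightarrow> 'l::complete_lattice) \<Rightarrow> 'l \<Rightarrow> 'a \<Rightarrow> ('a \<Rightarrow> 'l)"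
  where "lconj G \<eta> a z = (\<lambda>x. inf a (\<eta> (z \<otimes>\<^bsub>G\<^esub> x \<otimes>\<^bsub>G\<^esub> inv\<^bsub>G\<^esub> z)))"

definition L_contranormal ::
    "('a, 'b) monoid_scheme \<Rightarrow> ('a \<Rightarrow> 'l::complete_lattice) \<Rightarrow> ('a \<Rightarrow> 'l) \<Rightarrow> bool"
  where "L_contranormal G \<eta> \<mu> \<longleftrightarrow> L_subgroup_of G \<eta> \<mu> \<and>
    \<not> (\<exists>\<theta>. L_subgroup_of G \<theta> \<mu> \<and> \<not> lsub_eq G \<theta> \<mu> \<and>
          (\<forall>a z. lpoint_in G a z \<mu> \<longrightarrow> lsub_le G (lconj G \<eta> a z) \<theta>))"

definition normal_closure :: "('a, 'b) monoid_scheme \<Rightarrow> 'a set \<Rightarrow> 'a set"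
  where "normal_closure K S = \<Inter>{N. N \<lhd> K \<and> S \<subseteq> N}"

definition contranormal :: "'a set \<Rightarrow> ('a, 'b) monoid_scheme \<Rightarrow> bool"
  where "contranormal H K \<longleftrightarrow> subgroup H K \<and> normal_closure K H = carrier K"

end

theory Submission
  imports Defs
begin

text \<open>
  For the forward direction, let \<open>N\<close> be the normal closure of the \<open>t\<close>-level of \<open>\<eta>\<close> in the
  \<open>t\<close>-level of \<open>\<mu>\<close>. By the supstar condition, the supremum \<open>s\<close> of the values of \<open>\<eta>\<close>
  and \<open>\<mu>\<close> that are not \<open>\<ge> t\<close> is itself not \<open>\<ge> t\<close>. Cutting \<open>\<mu>\<close> down to \<open>\<mu> \<sqinter> s\<close> outside \<open>N\<close> gives an
  \<open>L\<close>-subgroup of \<open>\<mu>\<close> containing all conjugates of \<open>\<eta>\<close>; by contranormality it equals \<open>\<mu>\<close>, so no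
  element of the \<open>t\<close>-level of \<open>\<mu>\<close> lies outside \<open>N\<close>. Conversely, if \<open>\<theta>\<close> contains all conjugates
  of \<open>\<eta>\<close>, then for \<open>t = \<mu> x\<close> the \<open>t\<close>-level of \<open>\<theta>\<close> is a subgroup containing all conjugates of the
  \<open>t\<close>-level of \<open>\<eta>\<close>, so it contains \<open>x\<close>.
\<close>

section \<open>Normal closures in an ordinary group\<close>

lemma (in group) normal_closure_normal:
  assumes "S \<subseteq> carrier G"
  shows "normal_closure G S \<lhd> G"
proof -
  let ?F = "{N. N \<lhd> G \<and> S \<subseteq> N}"
  \<comment> \<open>An empty family would have the whole type as its intersection, so a member has
    to be exhibited.\<close>
  have "carrier G \<in> ?F"
    using assms subgroup_self by (auto simp: normal_inv_iff)
  then have "subgroup (\<Inter>?F) G"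
    by (intro subgroups_Inter) (auto simp: normal_inv_iff)
  then show ?thesis
    unfolding normal_closure_def by (auto simp: normal_inv_iff)
qed

lemma subset_normal_closure: "S \<subseteq> normal_closure K S"
  by (auto simp: normal_closure_def)

text \<open>The normal core of \<open>T\<close> is a normal subgroup containing \<open>S\<close>.\<close>
lemma (in group) normal_closure_subset:
  assumes T: "subgroup T G" and S: "S \<subseteq> carrier G"
    and conj: "\<And>z x. z \<in> carrier G \<Longrightarrow> x \<in> S \<Longrightarrow> z \<otimes> x \<otimes> inv z \<in> T"
  shows "normal_closure G S \<subseteq> T"
proof -
  define N where "N = {x \<in> carrier G. \<forall>z\<in>carrier G. z \<otimes> x \<otimes> inv z \<in> T}"
  have "subgroup N G"
  proof (rule subgroupI)
    show "N \<noteq> {}"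
      using subgroup.one_closed[OF T] by (auto simp: N_def intro!: exI[of _ \<one>])
  next
    fix a assume a: "a \<in> N"
    have "z \<otimes> inv a \<otimes> inv z \<in> T" if z: "z \<in> carrier G" for z
    proof -
      have "inv (z \<otimes> a \<otimes> inv z) \<in> T"
        using a z T by (auto simp: N_def intro: subgroup.m_inv_closed)
      then show ?thesis
        using a z by (simp add: N_def inv_mult_group m_assoc)
    qed
    then show "inv a \<in> N"
      using a by (auto simp: N_def)
  next
    fix a b assume ab: "a \<in> N" "b \<in> N"
    have "z \<otimes> (a \<otimes> b) \<otimes> inv z \<in> T" if z: "z \<in> carrier G" for z
    proof -
      have "(z \<otimes> a \<otimes> inv z) \<otimes> (z \<otimes> b \<otimes> inv z) \<in> T"
        using ab z T by (auto simp: N_def intro: subgroup.m_closed)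
      moreover have "(z \<otimes> a \<otimes> inv z) \<otimes> (z \<otimes> b \<otimes> inv z) = z \<otimes> (a \<otimes> b) \<otimes> inv z"
        using ab z by (simp add: N_def m_assoc inv_solve_left')
      ultimately show ?thesis by simp
    qed
    then show "a \<otimes> b \<in> N"
      using ab by (auto simp: N_def)
  qed (auto simp: N_def)
  moreover have "y \<otimes> x \<otimes> inv y \<in> N" if y: "y \<in> carrier G" and x: "x \<in> N" for x y
  proof -
    have "z \<otimes> (y \<otimes> x \<otimes> inv y) \<otimes> inv z \<in> T" if z: "z \<in> carrier G" for z
    proof -
      \<comment> \<open>Conjugating twice is conjugating by the product, so the condition defining
        \<open>N\<close> applies to \<open>x\<close> with conjugator
        \<open>z \<otimes> y\<close>.\<close>
      have "(z \<otimes> y) \<otimes> x \<otimes> inv (z \<otimes> y) \<in> T"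
        using x y z by (auto simp: N_def)
      then show ?thesis
        using x y z by (simp add: N_def inv_mult_group m_assoc)
    qed
    then show ?thesis
      using x y by (auto simp: N_def)
  qed
  ultimately have "N \<lhd> G"
    by (simp add: normal_inv_iff)
  moreover have "S \<subseteq> N"
    using S conj by (auto simp: N_def)
  ultimately have "normal_closure G S \<subseteq> N"
    by (auto simp: normal_closure_def)
  also have "N \<subseteq> T"
  proof
    fix x assume "x \<in> N"
    then have "x \<in> carrier G" "\<one> \<otimes> x \<otimes> inv \<one> \<in> T"
      unfolding N_def by blast+
    then show "x \<in> T" by simp
  qed
  finally show ?thesis .
qed

section \<open>Tips, level subsets and conjugates of \<open>L\<close>-subgroups\<close>

context group
begin

lemma L_subgroup_inf_le_mult:
  "L_subgroup G \<mu> \<Longrightarrow> x \<in> carrier G \<Longrightarrow> y \<in> carrier G \<Longrightarrow> inf (\<mu> x) (\<mu> y) \<le> \<mu> (x \<otimes> y)"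
  by (simp add: L_subgroup_def)

lemma L_subgroup_inv: "L_subgroup G \<mu> \<Longrightarrow> x \<in> carrier G \<Longrightarrow> \<mu> (inv x) = \<mu> x"
  by (simp add: L_subgroup_def)

text \<open>The values at \<open>x\<close> and \<open>inv x\<close> agree, so their meet is
  \<open>\<mu> x\<close>, while their product is \<open>\<one>\<close>. Hence the tip is attained at
  the identity.\<close>

lemma L_subgroup_le_one:
  assumes "L_subgroup G \<mu>" "x \<in> carrier G"
  shows "\<mu> x \<le> \<mu> \<one>"
  using L_subgroup_inf_le_mult[OF assms(1), of x "inv x"] assms by (simp add: L_subgroup_inv)

lemma lsub_tip_eq:
  assumes "L_subgroup G \<mu>"
  shows "lsub_tip G \<mu> = \<mu> \<one>"
  unfolding lsub_tip_def
  by (intro antisym SUP_least SUP_upper L_subgroup_le_one assms) simp_all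

lemma level_set_subgroup:
  assumes \<mu>: "L_subgroup G \<mu>" and t: "t \<le> \<mu> \<one>"
  shows "subgroup (level_set G \<mu> t) G"
proof (rule subgroupI)
  show "level_set G \<mu> t \<noteq> {}"
    using t by (auto simp: level_set_def)
next
  fix a b assume "a \<in> level_set G \<mu> t" "b \<in> level_set G \<mu> t"
  then show "a \<otimes> b \<in> level_set G \<mu> t"
    using L_subgroup_inf_le_mult[OF \<mu>, of a b]
    by (auto simp: level_set_def intro: order_trans[OF le_infI])
qed (auto simp: level_set_def L_subgroup_inv[OF \<mu>])

lemma level_set_subgroup_of:
  assumes \<eta>: "L_subgroup_of G \<eta> \<mu>" and \<mu>: "L_subgroup G \<mu>" and t: "t \<le> \<eta> \<one>"
  shows "subgroup (level_set G \<eta> t) (G\<lparr>carrier := level_set G \<mu> t\<rparr>)"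
proof (rule subgroup_incl)
  show "subgroup (level_set G \<eta> t) G"
    using \<eta> t by (intro level_set_subgroup) (auto simp: L_subgroup_of_def)
  show "subgroup (level_set G \<mu> t) G"
    using \<eta> t by (intro level_set_subgroup \<mu>) (auto simp: L_subgroup_of_def lsub_le_def intro: order_trans)
  show "level_set G \<eta> t \<subseteq> level_set G \<mu> t"
    using \<eta> by (auto simp: L_subgroup_of_def lsub_le_def level_set_def intro: order_trans)
qed

text \<open>Conjugating \<open>z \<otimes> x \<otimes> inv z\<close> back by \<open>inv z\<close>
  returns \<open>x\<close>, and \<open>a\<close> lies below \<open>\<mu>\<close> at both
  \<open>z\<close> and \<open>inv z\<close>. This bounds conjugates wherever the cut-down
  \<open>\<theta>\<close> below agrees with \<open>\<mu>\<close>.\<close>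

lemma lconj_le:
  assumes \<mu>: "L_subgroup G \<mu>" and \<eta>: "lsub_le G \<eta> \<mu>" and a: "lpoint_in G a z \<mu>"
  shows "lsub_le G (lconj G \<eta> a z) \<mu>"
  unfolding lsub_le_def
proof
  fix x assume x: "x \<in> carrier G"
  from a have z: "z \<in> carrier G" and az: "a \<le> \<mu> z"
    by (auto simp: lpoint_in_def)
  let ?y = "z \<otimes> x \<otimes> inv z"
  have y: "?y \<in> carrier G" using x z by simp
  have "lconj G \<eta> a z x \<le> inf (inf (\<mu> (inv z)) (\<mu> ?y)) (\<mu> z)"
    using az \<eta> y z by (auto simp: lconj_def lsub_le_def L_subgroup_inv[OF \<mu>] intro: le_infI1 le_infI2)
  also have "\<dots> \<le> inf (\<mu> (inv z \<otimes> ?y)) (\<mu> z)"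
    using y z by (intro inf_mono L_subgroup_inf_le_mult \<mu>) auto
  also have "\<dots> \<le> \<mu> (inv z \<otimes> ?y \<otimes> z)"
    using y z by (intro L_subgroup_inf_le_mult \<mu>) auto
  also have "inv z \<otimes> ?y \<otimes> z = x"
    using x z by (simp add: m_assoc inv_solve_left')
  finally show "lconj G \<eta> a z x \<le> \<mu> x" .
qed

lemma L_contranormalD:
  assumes "L_contranormal G \<eta> \<mu>" "L_subgroup_of G \<theta> \<mu>"
    and "\<And>a z. lpoint_in G a z \<mu> \<Longrightarrow> lsub_le G (lconj G \<eta> a z) \<theta>"
    and "x \<in> carrier G"
  shows "\<theta> x = \<mu> x"
  using assms by (auto simp: L_contranormal_def lsub_eq_def)

section \<open>From contranormal \<open>L\<close>-subgroups to their level subsets\<close>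

lemma level_set_contranormal:
  assumes \<mu>: "L_subgroup G \<mu>" and \<eta>: "L_subgroup_of G \<eta> \<mu>"
    and supstar: "jointly_supstar G \<eta> \<mu>"
    and contra: "L_contranormal G \<eta> \<mu>" and t: "t \<le> lsub_tip G \<eta>"
  shows "contranormal (level_set G \<eta> t) (G\<lparr>carrier := level_set G \<mu> t\<rparr>)"
proof -
  let ?M = "level_set G \<mu> t" and ?H = "level_set G \<eta> t"
  let ?K = "G\<lparr>carrier := ?M\<rparr>"
  have \<eta>L: "L_subgroup G \<eta>" and le: "lsub_le G \<eta> \<mu>"
    using \<eta> by (auto simp: L_subgroup_of_def)
  have t\<eta>: "t \<le> \<eta> \<one>"
    using t by (simp add: lsub_tip_eq[OF \<eta>L])
  then have t\<mu>: "t \<le> \<mu> \<one>"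
    using le by (auto simp: lsub_le_def intro: order_trans)
  have M: "subgroup ?M G"
    by (rule level_set_subgroup[OF \<mu> t\<mu>])
  have H: "subgroup ?H ?K"
    by (rule level_set_subgroup_of[OF \<eta> \<mu> t\<eta>])
  interpret K: group ?K
    by (rule subgroup_imp_group[OF M])
  define N where "N = normal_closure ?K ?H"
  have N: "N \<lhd> ?K"
    unfolding N_def using subgroup.subset[OF H] by (rule K.normal_closure_normal)
  have HN: "?H \<subseteq> N"
    unfolding N_def by (rule subset_normal_closure)
  have NM: "N \<subseteq> ?M"
    using normal_imp_subgroup[OF N] subgroup.subset by fastforce
  have NG: "subgroup N G"
    using incl_subgroup[OF M] normal_imp_subgroup[OF N] by simp
  have "?M \<subseteq> N"
  proof (rule ccontr)
    assume "\<not> ?M \<subseteq> N"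
    then obtain x0 where x0: "x0 \<in> carrier G" "t \<le> \<mu> x0" "x0 \<notin> N"
      by (auto simp: level_set_def)
    define V where "V = {v \<in> \<eta> ` carrier G \<union> \<mu> ` carrier G. \<not> t \<le> v}"
    define s where "s = Sup V"
    have s: "\<not> t \<le> s"
    proof (cases "V = {}")
      case True
      \<comment> \<open>Here \<open>s\<close> is the empty supremum \<open>bot\<close>. If
        \<open>t\<close> were \<open>bot\<close>, every element of \<open>G\<close>, including
        \<open>x0\<close>, would lie in \<open>?H\<close> and so in \<open>N\<close>.\<close>
      have "\<not> t \<le> bot"
      proof
        assume "t \<le> bot"
        then have "x0 \<in> ?H"
          using x0 by (auto simp: level_set_def bot_unique)
        then show False
          using HN x0 by auto
      qed
      with True show ?thesis by (simp add: s_def)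
    next
      case False
      then have "s \<in> V"
        using supstar unfolding s_def jointly_supstar_def supstar_def V_def
        by (metis (no_types, lifting) mem_Collect_eq subsetI)
      then show ?thesis by (simp add: V_def)
    qed
    \<comment> \<open>The threshold \<open>s\<close> splits the values of \<open>\<eta>\<close> and
      \<open>\<mu>\<close>: each is at most \<open>s\<close> or at least \<open>t\<close>.\<close>
    have above: "t \<le> v" if "v \<in> \<eta> ` carrier G \<union> \<mu> ` carrier G" "\<not> v \<le> s" for v
      using that Sup_upper[of v V] by (auto simp: V_def s_def)
    define \<theta> where "\<theta> = (\<lambda>x. if x \<in> N then \<mu> x else inf (\<mu> x) s)"
    have \<theta>le: "\<theta> x \<le> \<mu> x" for x
      by (simp add: \<theta>_def)
    have "L_subgroup G \<theta>"
      unfolding L_subgroup_def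
    proof (intro conjI ballI)
      fix x y assume xy: "x \<in> carrier G" "y \<in> carrier G"
      have m: "inf (\<theta> x) (\<theta> y) \<le> \<mu> (x \<otimes> y)"
        using inf_mono[OF \<theta>le \<theta>le] L_subgroup_inf_le_mult[OF \<mu> xy] by (rule order_trans)
      show "inf (\<theta> x) (\<theta> y) \<le> \<theta> (x \<otimes> y)"
      proof (cases "x \<otimes> y \<in> N")
        case True
        with m show ?thesis by (simp add: \<theta>_def)
      next
        \<comment> \<open>A product outside the subgroup \<open>N\<close> has a factor outside
          \<open>N\<close>, and there \<open>\<theta>\<close> is capped by \<open>s\<close>.\<close>
        case False
        then have "x \<notin> N \<or> y \<notin> N"
          using subgroup.m_closed[OF NG] by blast
        then have "inf (\<theta> x) (\<theta> y) \<le> s"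
          by (auto simp: \<theta>_def intro: le_infI1 le_infI2)
        with m False show ?thesis by (simp add: \<theta>_def)
      qed
    next
      fix x assume x: "x \<in> carrier G"
      have "inv x \<in> N \<longleftrightarrow> x \<in> N"
        using subgroup.m_inv_closed[OF NG] inv_inv[OF x] by metis
      then show "\<theta> (inv x) = \<theta> x"
        by (simp add: \<theta>_def L_subgroup_inv[OF \<mu> x])
    qed
    then have sub: "L_subgroup_of G \<theta> \<mu>"
      by (simp add: L_subgroup_of_def lsub_le_def \<theta>le)
    have "lsub_le G (lconj G \<eta> a z) \<theta>" if az: "lpoint_in G a z \<mu>" for a z
      unfolding lsub_le_def
    proof
      fix x assume x: "x \<in> carrier G"
      have z: "z \<in> carrier G" "a \<le> \<mu> z"
        using az by (auto simp: lpoint_in_def)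
      let ?y = "z \<otimes> x \<otimes> inv z"
      have y: "?y \<in> carrier G" using x z by simp
      have c\<mu>: "lconj G \<eta> a z x \<le> \<mu> x"
        using lconj_le[OF \<mu> le az] x by (simp add: lsub_le_def)
      show "lconj G \<eta> a z x \<le> \<theta> x"
      proof (cases "lconj G \<eta> a z x \<le> s")
        case True
        with c\<mu> show ?thesis by (simp add: \<theta>_def)
      next
        case False
        \<comment> \<open>A meet not below \<open>s\<close> has neither argument below
          \<open>s\<close>, so the threshold lifts both values to at least \<open>t\<close>.\<close>
        then have "\<not> \<mu> z \<le> s" "\<not> \<eta> ?y \<le> s"
          using z by (auto simp: lconj_def intro: le_infI1 le_infI2 order_trans)
        then have zM: "z \<in> ?M" and "?y \<in> ?H"
          using above z y by (auto simp: level_set_def)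
        then have "?y \<in> N" using HN by blast
        moreover have "inv z \<in> ?M"
          using zM M by (simp add: subgroup.m_inv_closed)
        \<comment> \<open>\<open>N\<close> is normal only in \<open>?M\<close>, which is why
          \<open>z\<close> had to be placed in \<open>?M\<close> before conjugating
          \<open>?y\<close> back to \<open>x\<close>.\<close>
        ultimately have "inv z \<otimes> ?y \<otimes> inv (inv z) \<in> N"
          using N M by (auto simp: K.normal_inv_iff m_inv_consistent)
        also have "inv z \<otimes> ?y \<otimes> inv (inv z) = x"
          using x z by (simp add: m_assoc inv_solve_left')
        finally show ?thesis
          using c\<mu> by (simp add: \<theta>_def)
      qed
    qed
    then have "\<theta> x0 = \<mu> x0"
      using L_contranormalD[OF contra sub] x0 by blast
    then have "\<mu> x0 \<le> s"
      using x0 by (simp add: \<theta>_def inf.absorb_iff1)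
    with s x0 show False
      using order_trans by blast
  qed
  with H NM show ?thesis
    by (auto simp: contranormal_def N_def)
qed

section \<open>From contranormal level subsets to contranormal \<open>L\<close>-subgroups\<close>

lemma L_contranormal_if_level_sets:
  assumes \<mu>: "L_subgroup G \<mu>" and \<eta>: "L_subgroup_of G \<eta> \<mu>"
    and tip: "lsub_tip G \<eta> = lsub_tip G \<mu>"
    and contra: "\<And>t. t \<le> lsub_tip G \<eta> \<Longrightarrow>
      contranormal (level_set G \<eta> t) (G\<lparr>carrier := level_set G \<mu> t\<rparr>)"
  shows "L_contranormal G \<eta> \<mu>"
proof -
  have \<eta>L: "L_subgroup G \<eta>"
    using \<eta> by (auto simp: L_subgroup_of_def)
  have one: "\<eta> \<one> = \<mu> \<one>"
    using tip by (simp add: lsub_tip_eq \<mu> \<eta>L)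
  have "\<theta> x = \<mu> x" if \<theta>: "L_subgroup_of G \<theta> \<mu>"
    and conj: "\<And>a z. lpoint_in G a z \<mu> \<Longrightarrow> lsub_le G (lconj G \<eta> a z) \<theta>"
    and x: "x \<in> carrier G" for \<theta> x
  proof (rule antisym)
    show "\<theta> x \<le> \<mu> x"
      using \<theta> x by (simp add: L_subgroup_of_def lsub_le_def)
    \<comment> \<open>At this level \<open>x\<close> lies in \<open>?M\<close>, and membership of
      \<open>x\<close> in the level subset of \<open>\<theta>\<close> is exactly the remaining
      inequality.\<close>
    define t where "t = \<mu> x"
    let ?M = "level_set G \<mu> t" and ?H = "level_set G \<eta> t"
    let ?K = "G\<lparr>carrier := ?M\<rparr>"
    have t\<mu>: "t \<le> \<mu> \<one>"
      unfolding t_def using \<mu> x by (rule L_subgroup_le_one)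
    have conjD: "inf a (\<eta> (z \<otimes> y \<otimes> inv z)) \<le> \<theta> y"
      if "z \<in> carrier G" "a \<le> \<mu> z" "y \<in> carrier G" for a z y
      using conj[of a z] that by (simp add: lpoint_in_def lsub_le_def lconj_def)
    \<comment> \<open>Conjugation by the identity at height \<open>\<mu> \<one>\<close> gives
      \<open>\<eta> \<one> \<le> \<theta> \<one>\<close>; with equal tips, \<open>\<theta>\<close>
      reaches the full tip of \<open>\<mu>\<close>.\<close>
    have t\<theta>: "t \<le> \<theta> \<one>"
      using conjD[of \<one> "\<mu> \<one>" \<one>] t\<mu> one by simp
    have M: "subgroup ?M G"
      by (rule level_set_subgroup[OF \<mu> t\<mu>])
    interpret K: group ?K
      by (rule subgroup_imp_group[OF M])
    have HK: "contranormal ?H ?K"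
      using contra t\<mu> by (simp add: tip lsub_tip_eq[OF \<mu>])
    have "normal_closure ?K ?H \<subseteq> level_set G \<theta> t"
    proof (rule K.normal_closure_subset)
      show "subgroup (level_set G \<theta> t) ?K"
        by (rule level_set_subgroup_of[OF \<theta> \<mu> t\<theta>])
      show "?H \<subseteq> carrier ?K"
        using HK subgroup.subset unfolding contranormal_def by blast
    next
      fix z y assume z: "z \<in> carrier ?K" and y: "y \<in> ?H"
      then have zG: "z \<in> carrier G" "t \<le> \<mu> z" and yG: "y \<in> carrier G" "t \<le> \<eta> y"
        by (auto simp: level_set_def)
      have "inv z \<otimes> (z \<otimes> y \<otimes> inv z) \<otimes> inv (inv z) = y"
        using zG yG by (simp add: m_assoc inv_solve_left')
      \<comment> \<open>Since \<open>lconj\<close> evaluates \<open>\<eta>\<close> at a conjugate of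
        its argument, the value of \<open>\<theta>\<close> at
        \<open>z \<otimes> y \<otimes> inv z\<close> is bounded through the \<open>L\<close>-point
        of height \<open>t\<close> at \<open>inv z\<close>.\<close>
      then have "t \<le> \<theta> (z \<otimes> y \<otimes> inv z)"
        using conjD[of "inv z" t "z \<otimes> y \<otimes> inv z"] zG yG
        by (simp add: L_subgroup_inv[OF \<mu>] inf_absorb1)
      then show "z \<otimes>\<^bsub>?K\<^esub> y \<otimes>\<^bsub>?K\<^esub> inv\<^bsub>?K\<^esub> z \<in> level_set G \<theta> t"
        using zG yG z M by (simp add: level_set_def m_inv_consistent)
    qed
    moreover have "x \<in> ?M"
      using x by (simp add: level_set_def t_def)
    ultimately have "x \<in> level_set G \<theta> t"
      using HK by (auto simp: contranormal_def)
    then show "\<mu> x \<le> \<theta> x"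
      by (simp add: level_set_def t_def)
  qed
  then show ?thesis
    using \<eta> unfolding L_contranormal_def lsub_eq_def by blast
qed

end

theorem theorem4p7:
  fixes G :: "('a, 'b) monoid_scheme"
    and \<mu> \<eta> :: "'a \<Rightarrow> 'l::complete_distrib_lattice"
  assumes "group G"
    and "L_subgroup G \<mu>"
    and "L_subgroup_of G \<eta> \<mu>"
  shows "((\<forall>a b :: 'l. a \<le> b \<or> b \<le> a) \<longrightarrow>
           jointly_supstar G \<eta> \<mu> \<longrightarrow>
           L_contranormal G \<eta> \<mu> \<longrightarrow>
           (\<forall>t. t \<le> lsub_tip G \<eta> \<longrightarrow>
              contranormal (level_set G \<eta> t) (G\<lparr>carrier := level_set G \<mu> t\<rparr>)))
       \<and> (lsub_tip G \<eta> = lsub_tip G \<mu> \<longrightarrow>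
           (\<forall>t. t \<le> lsub_tip G \<eta> \<longrightarrow>
              contranormal (level_set G \<eta> t) (G\<lparr>carrier := level_set G \<mu> t\<rparr>)) \<longrightarrow>
           L_contranormal G \<eta> \<mu>)"
  using assms group.level_set_contranormal group.L_contranormal_if_level_sets
  by blast

end
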